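(* Let $\mu$ and $\nu$ be two positive real numbers with $\mu<\nu$. Then the following inequalities hold: (1) $\left|L_2^2(\mu,\nu)-A^2(\mu,\nu)\right|\leq\dfrac{(\nu-\mu)^2}{12}$; (2) $\left|L_2^2(\mu,\nu)-\dfrac{2A^2(\mu,\nu)+A(\mu^2,\nu^2)}{3}\right|\leq\dfrac{2(\nu-\mu)^2}{81}$; (3) $\left|L_2^2(\mu,\nu)-\dfrac{A^2(\mu,\nu)+A(\mu^2,\nu^2)}{2}\right|\leq\dfrac{(\nu-\mu)^2}{24}$; (4) $\left|L_2^2(\mu,\nu)-A(\mu^2,\nu^2)\right|\leq\dfrac{(\nu-\mu)^2}{6}$.
   Context: For positive numbers $\mu\neq\nu$: the arithmetic mean is $A(\mu,\nu)=\frac{\mu+\nu}{2}$, and the generalized log-mean is $L_p(\mu,\nu)=\left[\frac{\nu^{p+1}-\mu^{p+1}}{(p+1)(\nu-\mu)}\right]^{1/p}$ for $p\neq-1,0$. Here $L_2^2(\mu,\nu)=(L_2(\mu,\nu))^2$ and $A^2(\mu,\nu)=(A(\mu,\nu))^2$. *)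

theory Defs
  imports Complex_Main
begin

definition arith_mean :: "real \<Rightarrow> real \<Rightarrow> real" where
  "arith_mean \<mu> \<nu> = (\<mu> + \<nu>) / 2"

text \<open>Meaningful for positive \<open>\<mu> \<noteq> \<nu>\<close> and real \<open>p\<close> different from \<open>-1\<close> and \<open>0\<close>; for those
  arguments the bases of all three real powers are positive.\<close>

definition gen_log_mean :: "real \<Rightarrow> real \<Rightarrow> real \<Rightarrow> real" where
  "gen_log_mean p \<mu> \<nu> =
     ((\<nu> powr (p + 1) - \<mu> powr (p + 1)) / ((p + 1) * (\<nu> - \<mu>))) powr (1 / p)"

end

theory Submission
  imports Defs
begin

text \<open>Everything reduces to exact identities in the midpoint \<open>m = (\<mu> + \<nu>) / 2\<close> and the
  length \<open>h = \<nu> - \<mu>\<close>. The square of \<open>L\<^sub>2\<close> is the average of \<open>x\<^sup>2\<close> over the interval, that is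
  \<open>m\<^sup>2\<close> plus the variance \<open>h\<^sup>2 / 12\<close> of the uniform distribution
  (\<open>gen_log_mean_2_squared\<close>); the average of \<open>x\<^sup>2\<close> over the two endpoints is
  \<open>m\<^sup>2 + h\<^sup>2 / 4\<close> (\<open>arith_mean_of_squares\<close>). The four differences are therefore
  \<open>h\<^sup>2 / 12\<close>, \<open>0\<close>, \<open>- h\<^sup>2 / 24\<close> and \<open>- h\<^sup>2 / 6\<close>: the first, third and fourth bounds are
  equalities, and the second compares with Simpson's rule, which is exact for \<open>x\<^sup>2\<close>.\<close>

lemma gen_log_mean_2_squared:
  fixes \<mu> \<nu> :: real
  assumes "0 < \<mu>" and "0 < \<nu>" and "\<mu> \<noteq> \<nu>"
  shows "(gen_log_mean 2 \<mu> \<nu>)\<^sup>2 = (arith_mean \<mu> \<nu>)\<^sup>2 + (\<nu> - \<mu>)\<^sup>2 / 12"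
proof -
  have cubes: "\<nu> powr 3 - \<mu> powr 3 = (\<nu> - \<mu>) * (\<mu>\<^sup>2 + \<mu> * \<nu> + \<nu>\<^sup>2)"
    using assms by (simp add: algebra_simps power2_eq_square power3_eq_cube)
  \<comment> \<open>The exponent stays unevaluated so that the left side is literally the base in
    \<open>gen_log_mean_def\<close> at \<open>p = 2\<close>.\<close>
  have base: "(\<nu> powr (2 + 1) - \<mu> powr (2 + 1)) / ((2 + 1) * (\<nu> - \<mu>)) = (\<mu>\<^sup>2 + \<mu> * \<nu> + \<nu>\<^sup>2) / 3"
    using cubes assms(3) by (simp add: divide_simps)
  have nonneg: "0 \<le> (\<mu>\<^sup>2 + \<mu> * \<nu> + \<nu>\<^sup>2) / 3"
    using assms by simp
  have "gen_log_mean 2 \<mu> \<nu> = sqrt ((\<mu>\<^sup>2 + \<mu> * \<nu> + \<nu>\<^sup>2) / 3)"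
    using powr_half_sqrt[OF nonneg] base by (simp only: gen_log_mean_def)
  then have "(gen_log_mean 2 \<mu> \<nu>)\<^sup>2 = (\<mu>\<^sup>2 + \<mu> * \<nu> + \<nu>\<^sup>2) / 3"
    using nonneg by simp
  then show ?thesis
    by (simp add: arith_mean_def power2_eq_square field_simps)
qed

lemma arith_mean_of_squares:
  "arith_mean (\<mu>\<^sup>2) (\<nu>\<^sup>2) = (arith_mean \<mu> \<nu>)\<^sup>2 + (\<nu> - \<mu>)\<^sup>2 / 4"
  by (simp add: arith_mean_def power2_eq_square field_simps)

theorem proposition14:
  fixes \<mu> \<nu> :: real
  assumes "0 < \<mu>" and "0 < \<nu>" and "\<mu> < \<nu>"
  shows "\<bar>(gen_log_mean 2 \<mu> \<nu>)\<^sup>2 - (arith_mean \<mu> \<nu>)\<^sup>2\<bar> \<le> (\<nu> - \<mu>)\<^sup>2 / 12 \<and>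
    \<bar>(gen_log_mean 2 \<mu> \<nu>)\<^sup>2
       - (2 * (arith_mean \<mu> \<nu>)\<^sup>2 + arith_mean (\<mu>\<^sup>2) (\<nu>\<^sup>2)) / 3\<bar>
      \<le> 2 * (\<nu> - \<mu>)\<^sup>2 / 81 \<and>
    \<bar>(gen_log_mean 2 \<mu> \<nu>)\<^sup>2
       - ((arith_mean \<mu> \<nu>)\<^sup>2 + arith_mean (\<mu>\<^sup>2) (\<nu>\<^sup>2)) / 2\<bar>
      \<le> (\<nu> - \<mu>)\<^sup>2 / 24 \<and>
    \<bar>(gen_log_mean 2 \<mu> \<nu>)\<^sup>2 - arith_mean (\<mu>\<^sup>2) (\<nu>\<^sup>2)\<bar> \<le> (\<nu> - \<mu>)\<^sup>2 / 6"
proof -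
  define m2 h2 where "m2 = (arith_mean \<mu> \<nu>)\<^sup>2" and "h2 = (\<nu> - \<mu>)\<^sup>2"
  have "(gen_log_mean 2 \<mu> \<nu>)\<^sup>2 = m2 + h2 / 12"
    using gen_log_mean_2_squared assms by (simp add: m2_def h2_def)
  moreover have "arith_mean (\<mu>\<^sup>2) (\<nu>\<^sup>2) = m2 + h2 / 4"
    by (simp add: arith_mean_of_squares m2_def h2_def)
  moreover have "0 \<le> h2"
    by (simp add: h2_def)
  ultimately show ?thesis
    unfolding m2_def[symmetric] h2_def[symmetric] by (simp add: abs_if field_simps)
qed

end
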